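(* The linearization of the evolution equation $$\tau_t = D_s\big(\tau^{-1/2}-\tau^{3/2}+D_s^2(\tau^{-1/2})\big)$$ around the stationary solutions of constant torsion is $$w_t+2w_s+\frac{1}{2}w_{sss}=0.$$
   Context: $D_s$ denotes the derivative with respect to $s$. The equation is the evolution equation of the torsion $\tau=\tau(s,t)>0$, as a function of arc-length $s$ and time $t$, for curves in $\mathbb{R}^3$ of constant curvature $1$ and strictly positive torsion moving by $X_t=\frac{1}{\sqrt{\tau}}\mathbf{B}$, where $\mathbf{B}$ is the unit binormal vector. The stationary solutions of constant torsion are those with $\tau$ constant; they correspond to helices. The linearization at a stationary solution $\tau_0$ is the equation for $w=w(s,t)$ obtained by letting $\tau=\tau_0+\epsilon w$, substituting into the evolution equation, dividing by $\epsilon$, and taking the limit as $\epsilon\to 0$ (that is, it is given by the Gateaux derivative of the differential operator at $\tau_0$ in the direction of $w$).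
   Formalization: The printed equation is the linearization only at constant torsion 1 (at torsion 4 the coefficient of w_sss is 1/16); for constant torsion τ₀ > 0 the coefficients of w_s and w_sss are (τ₀^{-3/2}+3τ₀^{1/2})/2 and τ₀^{-3/2}/2, and the printed equation arises after rescaling s and t. *)

theory Defs
  imports "HOL-Analysis.Analysis"
begin

text \<open>Functions of arc-length \<open>s\<close> and time \<open>t\<close> are curried, with \<open>s\<close> first.\<close>

definition D_s :: "(real \<Rightarrow> real \<Rightarrow> real) \<Rightarrow> real \<Rightarrow> real \<Rightarrow> real" where
  "D_s u = (\<lambda>s t. deriv (\<lambda>x. u x t) s)"

definition D_t :: "(real \<Rightarrow> real \<Rightarrow> real) \<Rightarrow> real \<Rightarrow> real \<Rightarrow> real" where
  "D_t u = (\<lambda>s t. deriv (\<lambda>y. u s y) t)"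

text \<open>The minimal regularity under which all derivatives occurring in the evolution equation
  (third order in \<open>s\<close>, first order in \<open>t\<close>) exist; in particular smooth functions qualify.\<close>

definition regular :: "(real \<Rightarrow> real \<Rightarrow> real) \<Rightarrow> bool" where
  "regular u \<longleftrightarrow> (\<forall>s t.
     (\<lambda>x. u x t) differentiable (at s) \<and>
     (\<lambda>x. D_s u x t) differentiable (at s) \<and>
     (\<lambda>x. D_s (D_s u) x t) differentiable (at s) \<and>
     (\<lambda>y. u s y) differentiable (at t))"

definition torsion_rhs :: "(real \<Rightarrow> real \<Rightarrow> real) \<Rightarrow> real \<Rightarrow> real \<Rightarrow> real" where
  "torsion_rhs \<tau> = D_s (\<lambda>s t. \<tau> s t powr (-1/2) - \<tau> s t powr (3/2)
                              + D_s (D_s (\<lambda>s t. \<tau> s t powr (-1/2))) s t)"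

definition torsion_operator :: "(real \<Rightarrow> real \<Rightarrow> real) \<Rightarrow> real \<Rightarrow> real \<Rightarrow> real" where
  "torsion_operator \<tau> = (\<lambda>s t. D_t \<tau> s t - torsion_rhs \<tau> s t)"

definition torsion_solution :: "(real \<Rightarrow> real \<Rightarrow> real) \<Rightarrow> bool" where
  "torsion_solution \<tau> \<longleftrightarrow>
     regular \<tau> \<and> (\<forall>s t. \<tau> s t > 0) \<and> (\<forall>s t. D_t \<tau> s t = torsion_rhs \<tau> s t)"

definition stationary_solution :: "(real \<Rightarrow> real \<Rightarrow> real) \<Rightarrow> bool" where
  "stationary_solution \<tau> \<longleftrightarrow> torsion_solution \<tau> \<and> (\<forall>s t. D_t \<tau> s t = 0)"

text \<open>Directional derivative at \<open>u\<close> in the direction \<open>w\<close>, with the limit taken at each point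
  \<open>(s, t)\<close>.  For \<open>u > 0\<close> and continuous \<open>w\<close>, \<open>u + \<epsilon> w\<close> is positive near \<open>(s, t)\<close> once \<open>\<epsilon>\<close> is
  small, so the values of \<open>powr\<close> at non-positive arguments play no role.\<close>

definition has_gateaux_derivative ::
  "((real \<Rightarrow> real \<Rightarrow> real) \<Rightarrow> real \<Rightarrow> real \<Rightarrow> real) \<Rightarrow> (real \<Rightarrow> real \<Rightarrow> real)
     \<Rightarrow> (real \<Rightarrow> real \<Rightarrow> real) \<Rightarrow> (real \<Rightarrow> real \<Rightarrow> real) \<Rightarrow> bool" where
  "has_gateaux_derivative E u w g \<longleftrightarrow>
     (\<forall>s t. ((\<lambda>\<epsilon>. (E (\<lambda>s t. u s t + \<epsilon> * w s t) s t - E u s t) / \<epsilon>) \<longlongrightarrow> g s t) (at 0))"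

text \<open>The linearization of \<open>E \<tau> = 0\<close> at \<open>u\<close> is the equation \<open>L w = 0\<close>.\<close>

definition is_linearization ::
  "((real \<Rightarrow> real \<Rightarrow> real) \<Rightarrow> real \<Rightarrow> real \<Rightarrow> real) \<Rightarrow> (real \<Rightarrow> real \<Rightarrow> real)
     \<Rightarrow> ((real \<Rightarrow> real \<Rightarrow> real) \<Rightarrow> real \<Rightarrow> real \<Rightarrow> real) \<Rightarrow> bool" where
  "is_linearization E u L \<longleftrightarrow> (\<forall>w. regular w \<longrightarrow> has_gateaux_derivative E u w (L w))"

end

theory Submission
  imports Defs
begin

text \<open>At a point where \<open>u > 0\<close> the operator is an explicit polynomial in powers of \<open>u\<close> and in
  \<open>u\<^sub>s, u\<^sub>s\<^sub>s, u\<^sub>s\<^sub>s\<^sub>s\<close>. Substituting \<open>\<tau>\<^sub>0 + \<epsilon> w\<close>, every term carries a factor \<open>\<epsilon>\<close>, and after dividing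
  by \<open>\<epsilon>\<close> the limit keeps only the terms linear in \<open>w\<close>. Testing with \<open>w = s\<^sup>3\<close> at \<open>s = 0\<close> shows that
  the coefficient of \<open>w\<^sub>s\<^sub>s\<^sub>s\<close> is \<open>1/2\<close> only for \<open>\<tau>\<^sub>0 = 1\<close>; for other \<open>\<tau>\<^sub>0\<close> the two free scales in \<open>s\<close>
  and \<open>t\<close> normalise the two coefficients.\<close>

lemma regular_DERIV:
  assumes "regular u"
  shows "((\<lambda>x. u x t) has_real_derivative D_s u s t) (at s)"
    and "((\<lambda>x. D_s u x t) has_real_derivative D_s (D_s u) s t) (at s)"
    and "((\<lambda>x. D_s (D_s u) x t) has_real_derivative D_s (D_s (D_s u)) s t) (at s)"
    and "((\<lambda>y. u s y) has_real_derivative D_t u s t) (at t)"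
  using assms DERIV_deriv_iff_real_differentiable
  unfolding regular_def D_s_def D_t_def by blast+

lemma D_s_eqI: "((\<lambda>x. u x t) has_real_derivative d) (at s) \<Longrightarrow> D_s u s t = d"
  unfolding D_s_def by (rule DERIV_imp_deriv)

lemma D_t_eqI: "((\<lambda>y. u s y) has_real_derivative d) (at t) \<Longrightarrow> D_t u s t = d"
  unfolding D_t_def by (rule DERIV_imp_deriv)

text \<open>Since \<open>deriv\<close> is a total function, pointwise derivatives along explicit
  candidates identify the iterated derivatives as equal functions, so they can be used as rewrite
  rules.\<close>

lemma regularI:
  assumes "\<And>s t. ((\<lambda>x. u x t) has_real_derivative u1 s t) (at s)"
    and "\<And>s t. ((\<lambda>x. u1 x t) has_real_derivative u2 s t) (at s)"
    and "\<And>s t. ((\<lambda>x. u2 x t) has_real_derivative u3 s t) (at s)"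
    and "\<And>s t. ((\<lambda>y. u s y) has_real_derivative ut s t) (at t)"
  shows "regular u" "D_s u = u1" "D_s (D_s u) = u2" "D_s (D_s (D_s u)) = u3" "D_t u = ut"
proof -
  show 1: "D_s u = u1" using assms(1) by (intro ext D_s_eqI)
  then show 2: "D_s (D_s u) = u2" using assms(2) by (auto intro!: ext D_s_eqI)
  then show "D_s (D_s (D_s u)) = u3" using assms(3) by (auto intro!: ext D_s_eqI)
  show "D_t u = ut" using assms(4) by (intro ext D_t_eqI)
  show "regular u"
    \<comment> \<open>The second derivative is rewritten first: \<open>D_s u\<close> is a subterm of
      \<open>D_s (D_s u)\<close>, so the reverse order would destroy the redex.\<close>
    unfolding regular_def 2 unfolding 1 unfolding real_differentiable_def using assms by blast
qed

lemma regular_perturbation: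
  fixes c \<epsilon> :: real
  assumes "regular w"
  defines "u \<equiv> \<lambda>s t. c + \<epsilon> * w s t"
  shows "regular u" "D_s u = (\<lambda>s t. \<epsilon> * D_s w s t)"
    "D_s (D_s u) = (\<lambda>s t. \<epsilon> * D_s (D_s w) s t)"
    "D_s (D_s (D_s u)) = (\<lambda>s t. \<epsilon> * D_s (D_s (D_s w)) s t)"
    "D_t u = (\<lambda>s t. \<epsilon> * D_t w s t)"
  unfolding u_def
  by (rule regularI[of _ "\<lambda>s t. \<epsilon> * D_s w s t" "\<lambda>s t. \<epsilon> * D_s (D_s w) s t"
      "\<lambda>s t. \<epsilon> * D_s (D_s (D_s w)) s t" "\<lambda>s t. \<epsilon> * D_t w s t"];
    auto intro!: derivative_eq_intros regular_DERIV[OF assms(1)])+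

text \<open>The second form is closed under iteration: each differentiation adds one factor
  \<open>a\<close> to the prefactor.\<close>

lemma DERIV_scale:
  fixes f :: "real \<Rightarrow> real"
  assumes "(f has_real_derivative d) (at (a * x))"
  shows "((\<lambda>x. f (a * x)) has_real_derivative a * d) (at x)"
    and "((\<lambda>x. a ^ n * f (a * x)) has_real_derivative a ^ Suc n * d) (at x)"
proof -
  show 1: "((\<lambda>x. f (a * x)) has_real_derivative a * d) (at x)"
    using DERIV_chain2[OF assms DERIV_cmult_Id] by (simp add: mult.commute)
  show "((\<lambda>x. a ^ n * f (a * x)) has_real_derivative a ^ Suc n * d) (at x)"
    using DERIV_cmult[OF 1, of "a ^ n"] by (simp add: mult_ac)
qed

text \<open>Provides the change of scales in \<open>s\<close> and \<open>t\<close> that later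
  normalises the coefficients of the linearized equation.\<close>

lemma regular_rescale:
  fixes a b :: real
  assumes "regular v"
  defines "w \<equiv> \<lambda>s t. v (a * s) (b * t)"
  shows "regular w" "D_s w = (\<lambda>s t. a * D_s v (a * s) (b * t))"
    "D_s (D_s w) = (\<lambda>s t. a^2 * D_s (D_s v) (a * s) (b * t))"
    "D_s (D_s (D_s w)) = (\<lambda>s t. a^3 * D_s (D_s (D_s v)) (a * s) (b * t))"
    "D_t w = (\<lambda>s t. b * D_t v (a * s) (b * t))"
proof -
  note d = regular_DERIV[OF assms(1)]
  have *: "((\<lambda>x. w x t) has_real_derivative a * D_s v (a * s) (b * t)) (at s)"
    "((\<lambda>x. a * D_s v (a * x) (b * t)) has_real_derivative a^2 * D_s (D_s v) (a * s) (b * t)) (at s)"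
    "((\<lambda>x. a^2 * D_s (D_s v) (a * x) (b * t)) has_real_derivative
      a^3 * D_s (D_s (D_s v)) (a * s) (b * t)) (at s)"
    "((\<lambda>y. w s y) has_real_derivative b * D_t v (a * s) (b * t)) (at t)" for s t
    using DERIV_scale(1)[OF d(1)] DERIV_scale(2)[OF d(2), where n=1]
      DERIV_scale(2)[OF d(3), where n=2] DERIV_scale(1)[OF d(4)]
    unfolding w_def by (simp_all add: numeral_eq_Suc)
  show "regular w" "D_s w = (\<lambda>s t. a * D_s v (a * s) (b * t))"
    "D_s (D_s w) = (\<lambda>s t. a^2 * D_s (D_s v) (a * s) (b * t))"
    "D_s (D_s (D_s w)) = (\<lambda>s t. a^3 * D_s (D_s (D_s v)) (a * s) (b * t))"
    "D_t w = (\<lambda>s t. b * D_t v (a * s) (b * t))"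
    by (rule regularI[OF *])+
qed

lemma DERIV_powr_const:
  fixes r :: real
  assumes "(g has_real_derivative g') (at x)" "g x > 0"
  shows "((\<lambda>x. g x powr r) has_real_derivative r * g x powr (r - 1) * g') (at x)"
  using DERIV_chain2[OF has_real_derivative_powr[OF assms(2)] assms(1)] .

text \<open>Chain and product rule. Positivity at the single point suffices, because only
  \<open>s\<close>-derivatives occur and continuity in \<open>s\<close> spreads it to a
  neighbourhood on the line of fixed \<open>t\<close>.\<close>

lemma torsion_rhs_expand:
  assumes reg: "regular u" and pos: "u s t > 0"
  shows "torsion_rhs u s t =
      - (u s t powr (-3/2) + 3 * u s t powr (1/2)) / 2 * D_s u s t
      - 15/8 * u s t powr (-7/2) * (D_s u s t)^3
      + 9/4 * u s t powr (-5/2) * D_s u s t * D_s (D_s u) s t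
      - 1/2 * u s t powr (-3/2) * D_s (D_s (D_s u)) s t"
proof -
  note d = regular_DERIV[OF reg]
  define S where "S = {x. u x t > 0}"
  have "continuous_on UNIV (\<lambda>x. u x t)"
    using d(1) by (meson DERIV_isCont continuous_at_imp_continuous_on)
  then have S: "open S"
    unfolding S_def by (simp add: open_Collect_less)
  \<comment> \<open>\<open>h1\<close>, \<open>h2\<close>, \<open>h3\<close> are the first three
    \<open>s\<close>-derivatives of \<open>u powr (-1/2)\<close> at fixed \<open>t\<close>.\<close>
  define h1 where "h1 x = -1/2 * u x t powr (-3/2) * D_s u x t" for x
  define h2 where "h2 x = 3/4 * u x t powr (-5/2) * (D_s u x t)^2
    - 1/2 * u x t powr (-3/2) * D_s (D_s u) x t" for x
  define h3 where "h3 x = - 15/8 * u x t powr (-7/2) * (D_s u x t)^3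
      + 9/4 * u x t powr (-5/2) * D_s u x t * D_s (D_s u) x t
      - 1/2 * u x t powr (-3/2) * D_s (D_s (D_s u)) x t" for x
  have pw: "((\<lambda>x. u x t powr r) has_real_derivative r * u x t powr (r - 1) * D_s u x t) (at x)"
    if "x \<in> S" for x r
    using that d(1) unfolding S_def by (auto intro!: DERIV_powr_const)
  have H1: "D_s (\<lambda>s t. u s t powr (-1/2)) x t = h1 x" if "x \<in> S" for x
    using pw[OF that, of "-1/2"] unfolding h1_def by (intro D_s_eqI) simp
  have e1: "(h1 has_real_derivative h2 x) (at x)" if "x \<in> S" for x
    unfolding h1_def
    by (rule DERIV_cong[OF DERIV_mult[OF DERIV_cmult[OF pw[OF that]] d(2)]])
      (simp add: h2_def power2_eq_square mult_ac)
  have H2: "D_s (D_s (\<lambda>s t. u s t powr (-1/2))) x t = h2 x" if "x \<in> S" for x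
    \<comment> \<open>The inner derivative equals \<open>h1\<close> only where \<open>u > 0\<close>;
      openness of \<open>S\<close> allows differentiating that identity once more.\<close>
    by (rule D_s_eqI, rule has_field_derivative_transform_within_open[OF e1[OF that] S that])
      (rule H1[symmetric])
  have e2: "(h2 has_real_derivative h3 x) (at x)" if "x \<in> S" for x
    unfolding h2_def
    by (rule DERIV_cong[OF DERIV_diff[OF DERIV_mult[OF DERIV_cmult[OF pw[OF that]] DERIV_power[OF d(2)]]
          DERIV_mult[OF DERIV_cmult[OF pw[OF that]] d(3)]]])
      (simp add: h3_def power2_eq_square power3_eq_cube algebra_simps)
  have s: "s \<in> S" using pos by (simp add: S_def)
  have e3: "((\<lambda>x. u x t powr (-1/2) - u x t powr (3/2)
      + D_s (D_s (\<lambda>s t. u s t powr (-1/2))) x t) has_real_derivative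
      -1/2 * u s t powr (-1/2 - 1) * D_s u s t - 3/2 * u s t powr (3/2 - 1) * D_s u s t + h3 s) (at s)"
    by (intro DERIV_add DERIV_diff pw s)
      (rule has_field_derivative_transform_within_open[OF e2[OF s] S s], rule H2[symmetric])
  show ?thesis
    unfolding torsion_rhs_def by (subst D_s_eqI, rule e3) (simp add: h3_def field_simps)
qed

lemma torsion_rhs_const: "torsion_rhs (\<lambda>s t. c) = (\<lambda>s t. 0)"
  by (simp add: torsion_rhs_def D_s_def)

lemma regular_const: "regular (\<lambda>s t. c)"
  by (rule regularI(1)[of _ "\<lambda>s t. 0" "\<lambda>s t. 0" "\<lambda>s t. 0" "\<lambda>s t. 0"]; rule DERIV_const)

lemma D_t_const: "D_t (\<lambda>s t. c) = (\<lambda>s t. 0)"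
  by (simp add: D_t_def)

text \<open>The operator vanishes at constants, and at \<open>c + \<epsilon> * w\<close> each term
  has at least one factor \<epsilon>; the products of several derivatives keep a further \<epsilon>
  after division and vanish in the limit.\<close>

lemma torsion_operator_linearization:
  assumes pos: "c > 0"
  shows "is_linearization torsion_operator (\<lambda>s t. c)
    (\<lambda>w s t. D_t w s t + (c powr (-3/2) + 3 * c powr (1/2)) / 2 * D_s w s t
       + c powr (-3/2) / 2 * D_s (D_s (D_s w)) s t)"
  unfolding is_linearization_def has_gateaux_derivative_def
proof (intro allI impI)
  fix w :: "real \<Rightarrow> real \<Rightarrow> real" and s t :: real
  assume w: "regular w"
  define p where "p \<epsilon> = c + \<epsilon> * w s t" for \<epsilon>
  \<comment> \<open>The difference quotient with \<epsilon> already cancelled, hence continuous at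
    \<epsilon> = 0.\<close>
  define G where "G \<epsilon> = D_t w s t + (p \<epsilon> powr (-3/2) + 3 * p \<epsilon> powr (1/2)) / 2 * D_s w s t
      + 15/8 * p \<epsilon> powr (-7/2) * (\<epsilon>^2 * (D_s w s t)^3)
      - 9/4 * p \<epsilon> powr (-5/2) * (\<epsilon> * D_s w s t * D_s (D_s w) s t)
      + 1/2 * p \<epsilon> powr (-3/2) * D_s (D_s (D_s w)) s t" for \<epsilon>
  have p: "(p \<longlongrightarrow> c) (at 0)"
    unfolding p_def by (auto intro!: tendsto_eq_intros)
  have "(G \<longlongrightarrow> D_t w s t + (c powr (-3/2) + 3 * c powr (1/2)) / 2 * D_s w s t
      + 15/8 * c powr (-7/2) * (0^2 * (D_s w s t)^3)
      - 9/4 * c powr (-5/2) * (0 * D_s w s t * D_s (D_s w) s t)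
      + 1/2 * c powr (-3/2) * D_s (D_s (D_s w)) s t) (at 0)"
    unfolding G_def using pos by (intro tendsto_intros p) auto
  then have lim: "(G \<longlongrightarrow> D_t w s t + (c powr (-3/2) + 3 * c powr (1/2)) / 2 * D_s w s t
       + c powr (-3/2) / 2 * D_s (D_s (D_s w)) s t) (at 0)"
    by simp
  \<comment> \<open>Positivity licenses the explicit expansion at \<open>(s, t)\<close>, and
    \<epsilon> \<noteq> 0 the cancellation.\<close>
  have "\<forall>\<^sub>F \<epsilon> in at 0. p \<epsilon> > 0 \<and> \<epsilon> \<noteq> 0"
    using order_tendstoD(1)[OF p pos] by (auto simp: eventually_conj_iff eventually_at_filter)
  then have ev: "\<forall>\<^sub>F \<epsilon> in at 0. G \<epsilon> = (torsion_operator (\<lambda>s t. c + \<epsilon> * w s t) s t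
      - torsion_operator (\<lambda>s t. c) s t) / \<epsilon>"
  proof eventually_elim
    case (elim \<epsilon>)
    note r = regular_perturbation[OF w, of c \<epsilon>]
    have e: "torsion_rhs (\<lambda>s t. c + \<epsilon> * w s t) s t =
        - (p \<epsilon> powr (-3/2) + 3 * p \<epsilon> powr (1/2)) / 2 * (\<epsilon> * D_s w s t)
        - 15/8 * p \<epsilon> powr (-7/2) * (\<epsilon> * D_s w s t)^3
        + 9/4 * p \<epsilon> powr (-5/2) * (\<epsilon> * D_s w s t) * (\<epsilon> * D_s (D_s w) s t)
        - 1/2 * p \<epsilon> powr (-3/2) * (\<epsilon> * D_s (D_s (D_s w)) s t)"
      using elim torsion_rhs_expand[OF r(1), of s t] unfolding r(4) unfolding r(3) unfolding r(2)
      by (simp add: p_def)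
    have "torsion_operator (\<lambda>s t. c + \<epsilon> * w s t) s t = \<epsilon> * G \<epsilon>"
      unfolding torsion_operator_def e r(5) G_def
      by (simp add: field_simps power2_eq_square power3_eq_cube)
    then show ?case
      using elim by (simp add: torsion_operator_def torsion_rhs_const D_t_const)
  qed
  show "((\<lambda>\<epsilon>. (torsion_operator (\<lambda>s t. c + \<epsilon> * w s t) s t
      - torsion_operator (\<lambda>s t. c) s t) / \<epsilon>)
    \<longlongrightarrow> D_t w s t + (c powr (-3/2) + 3 * c powr (1/2)) / 2 * D_s w s t
       + c powr (-3/2) / 2 * D_s (D_s (D_s w)) s t) (at 0)"
    using Lim_transform_eventually[OF lim ev] .
qed

lemma is_linearization_unique:
  assumes "is_linearization E u L" "is_linearization E u L'" "regular w"
  shows "L w = L' w"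
proof (intro ext)
  fix s t
  show "L w s t = L' w s t"
    using assms unfolding is_linearization_def has_gateaux_derivative_def
    by (blast intro: LIM_unique)
qed

text \<open>A test function that isolates the third-order coefficient: at \<open>s = 0\<close> its
  other derivatives in the linearized equation vanish.\<close>

lemma regular_cube:
  defines "w \<equiv> \<lambda>s (t::real). s^3 :: real"
  shows "regular w" "D_s w = (\<lambda>s t. 3 * s^2)" "D_s (D_s w) = (\<lambda>s t. 6 * s)"
    "D_s (D_s (D_s w)) = (\<lambda>s t. 6)" "D_t w = (\<lambda>s t. 0)"
  unfolding w_def by (rule regularI[of _ "\<lambda>s t. 3 * s^2" "\<lambda>s t. 6 * s" "\<lambda>s t. 6" "\<lambda>s t. 0"];
    auto intro!: derivative_eq_intros)+

text \<open>The coefficients 2 and 1/2 belong to unit torsion. For any other helix they appear in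
  rescaled variables, up to an overall factor \<open>b > 0\<close> that does not change the
  equation.\<close>

theorem proposition3p3:
  fixes \<tau>\<^sub>0 :: real
  assumes "\<tau>\<^sub>0 > 0"
  shows "stationary_solution (\<lambda>s t. \<tau>\<^sub>0)
    \<and> is_linearization torsion_operator (\<lambda>s t. \<tau>\<^sub>0)
        (\<lambda>w s t. D_t w s t
           + (\<tau>\<^sub>0 powr (-3/2) + 3 * \<tau>\<^sub>0 powr (1/2)) / 2 * D_s w s t
           + \<tau>\<^sub>0 powr (-3/2) / 2 * D_s (D_s (D_s w)) s t)
    \<and> (is_linearization torsion_operator (\<lambda>s t. \<tau>\<^sub>0)
         (\<lambda>w s t. D_t w s t + 2 * D_s w s t + 1/2 * D_s (D_s (D_s w)) s t)
       \<longleftrightarrow> \<tau>\<^sub>0 = 1)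
    \<and> (\<exists>a>0. \<exists>b>0. \<forall>v. regular v \<longrightarrow>
         has_gateaux_derivative torsion_operator (\<lambda>s t. \<tau>\<^sub>0) (\<lambda>s t. v (a * s) (b * t))
           (\<lambda>s t. b * (D_t v (a * s) (b * t) + 2 * D_s v (a * s) (b * t)
                        + 1/2 * D_s (D_s (D_s v)) (a * s) (b * t))))"
proof (intro conjI)
  define P Q where "P = \<tau>\<^sub>0 powr (-3/2)" and "Q = \<tau>\<^sub>0 powr (1/2)"
  have P: "P > 0" and Q: "Q > 0" using assms by (simp_all add: P_def Q_def)
  note lin = torsion_operator_linearization[OF assms]
  show "stationary_solution (\<lambda>s t. \<tau>\<^sub>0)"
    unfolding stationary_solution_def torsion_solution_def
    using assms by (simp add: regular_const torsion_rhs_const D_t_const)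
  show "is_linearization torsion_operator (\<lambda>s t. \<tau>\<^sub>0)
        (\<lambda>w s t. D_t w s t
           + (\<tau>\<^sub>0 powr (-3/2) + 3 * \<tau>\<^sub>0 powr (1/2)) / 2 * D_s w s t
           + \<tau>\<^sub>0 powr (-3/2) / 2 * D_s (D_s (D_s w)) s t)"
    by (rule lin)
  show "is_linearization torsion_operator (\<lambda>s t. \<tau>\<^sub>0)
         (\<lambda>w s t. D_t w s t + 2 * D_s w s t + 1/2 * D_s (D_s (D_s w)) s t)
       \<longleftrightarrow> \<tau>\<^sub>0 = 1" (is "?A \<longleftrightarrow> _")
  proof
    assume ?A
    \<comment> \<open>At the origin the two linearizations of the cube reduce to 1/2 * 6 and
      \<open>\<tau>\<^sub>0 powr (-3/2) / 2 * 6\<close>.\<close>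
    from fun_cong[OF fun_cong[OF is_linearization_unique[OF this lin regular_cube(1)]], of 0 0]
    have "\<tau>\<^sub>0 powr (-3/2) = 1"
      unfolding regular_cube(4) unfolding regular_cube(2,5) by simp
    then show "\<tau>\<^sub>0 = 1"
      using assms powr_eq_one_iff_gen[where a = \<tau>\<^sub>0 and x = "-3/2"] by auto
  next
    assume "\<tau>\<^sub>0 = 1"
    then show ?A using lin by simp
  qed
  \<comment> \<open>For \<open>w s t = v (a * s) (b * t)\<close> the coefficients become
    \<open>b\<close>, \<open>(P + 3 * Q) / 2 * a\<close> and \<open>P / 2 * a^3\<close>. The ratio 1
    : 2 : 1/2 forces \<open>b = P * a^3\<close> and then
    \<open>a^2 = (P + 3 * Q) / (4 * P)\<close>.\<close>
  define a where "a = sqrt ((P + 3 * Q) / (4 * P))"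
  define b where "b = P * a^3"
  have a: "a > 0" and b: "b > 0" using P Q by (simp_all add: a_def b_def)
  have "a^2 = (P + 3 * Q) / (4 * P)" using P Q by (simp add: a_def)
  then have "P + 3 * Q = 4 * P * a^2" using P by (simp add: field_simps)
  then have *: "(P + 3 * Q) / 2 * a = 2 * b"
    by (simp add: b_def power3_eq_cube power2_eq_square)
  have "has_gateaux_derivative torsion_operator (\<lambda>s t. \<tau>\<^sub>0) (\<lambda>s t. v (a * s) (b * t))
           (\<lambda>s t. b * (D_t v (a * s) (b * t) + 2 * D_s v (a * s) (b * t)
                        + 1/2 * D_s (D_s (D_s v)) (a * s) (b * t)))" if v: "regular v" for v
  proof -
    note r = regular_rescale[OF v, of a b]
    have "b * y + (P + 3 * Q) / 2 * (a * z) + P / 2 * (a^3 * x) = b * (y + 2 * z + 1/2 * x)" for x y z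
    proof -
      have "(P + 3 * Q) / 2 * (a * z) = 2 * b * z" using * by (metis mult.assoc)
      then show ?thesis by (simp add: b_def algebra_simps)
    qed
    then show ?thesis
      using lin[unfolded is_linearization_def, rule_format, OF r(1)]
      unfolding r(4) unfolding r(2,5) P_def[symmetric] Q_def[symmetric] by simp
  qed
  with a b show "\<exists>a>0. \<exists>b>0. \<forall>v. regular v \<longrightarrow>
         has_gateaux_derivative torsion_operator (\<lambda>s t. \<tau>\<^sub>0) (\<lambda>s t. v (a * s) (b * t))
           (\<lambda>s t. b * (D_t v (a * s) (b * t) + 2 * D_s v (a * s) (b * t)
                        + 1/2 * D_s (D_s (D_s v)) (a * s) (b * t)))"
    by blast
qed

end
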